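(* Let $S=\mathbb{Z}\langle a,b,c : (1-ab)c=1,\ c(1-ab)=1\rangle$ be the unital associative $\mathbb{Z}$-algebra generated by $a,b,c$ with defining relations $(1-ab)c=1$ and $c(1-ab)=1$. Then the system of equations $$(1-ba)x=1,\qquad x(1-ba)=1$$ has a unique solution $x$ in $S$.
   Context: $\mathbb{Z}\langle a,b,c\rangle$ denotes the free unital associative $\mathbb{Z}$-algebra on the (non-commuting) generators $a,b,c$. The algebra $S$ is the quotient of $\mathbb{Z}\langle a,b,c\rangle$ by the two-sided ideal generated by $(1-ab)c-1$ and $c(1-ab)-1$; the images of $a,b,c$ in $S$ are denoted by the same letters. *)

theory Defs
  imports "HOL-Algebra.QuotRing" "HOL-Library.Poly_Mapping"
begin

text \<open>
  The free monoid on \<open>'g\<close>: lists under concatenation, written additively because the product on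
  \<^typ>\<open>'m \<Rightarrow>\<^sub>0 'r\<close> is the convolution along \<open>+\<close> on \<open>'m\<close>. Class \<^class>\<open>monoid_add\<close> does not
  require commutativity.
\<close>

datatype 'g free_monoid = Word "'g list"

instantiation free_monoid :: (type) monoid_add
begin

definition zero_free_monoid :: "'a free_monoid" where
  "0 = Word []"

fun plus_free_monoid :: "'a free_monoid \<Rightarrow> 'a free_monoid \<Rightarrow> 'a free_monoid" where
  "Word u + Word v = Word (u @ v)"

instance
proof
  fix x y z :: "'a free_monoid"
  show "x + y + z = x + (y + z)"
    by (cases x; cases y; cases z) simp
  show "0 + x = x" "x + 0 = x"
    by (cases x; simp add: zero_free_monoid_def)+
qed

end

text \<open>
  The free unital associative \<open>\<int>\<close>-algebra on \<open>'g\<close> is the monoid ring of the free monoid over \<open>\<int>\<close>.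
\<close>

definition free_algebra :: "('g free_monoid \<Rightarrow>\<^sub>0 int) ring" where
  "free_algebra = \<lparr>carrier = UNIV, mult = (*), one = 1, zero = 0, add = (+)\<rparr>"

definition free_gen :: "'g \<Rightarrow> ('g free_monoid \<Rightarrow>\<^sub>0 int)" where
  "free_gen g = Poly_Mapping.single (Word [g]) 1"

lemma ring_free_algebra: "ring (free_algebra :: ('g free_monoid \<Rightarrow>\<^sub>0 int) ring)"
proof (rule ringI)
  show "abelian_group (free_algebra :: ('g free_monoid \<Rightarrow>\<^sub>0 int) ring)"
  proof (rule abelian_groupI)
    fix x :: "'g free_monoid \<Rightarrow>\<^sub>0 int"
    show "\<exists>y \<in> carrier free_algebra. y \<oplus>\<^bsub>free_algebra\<^esub> x = \<zero>\<^bsub>free_algebra\<^esub>"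
      by (rule bexI[of _ "- x"]) (simp_all add: free_algebra_def)
  qed (auto simp: free_algebra_def algebra_simps)
  show "monoid (free_algebra :: ('g free_monoid \<Rightarrow>\<^sub>0 int) ring)"
    by unfold_locales (auto simp: free_algebra_def algebra_simps)
qed (auto simp: free_algebra_def algebra_simps)

datatype abc = gen_a | gen_b | gen_c

text \<open>\<^const>\<open>genideal\<close> is the generated two-sided ideal.\<close>

definition rel_ideal :: "(abc free_monoid \<Rightarrow>\<^sub>0 int) set" where
  "rel_ideal = genideal free_algebra
     {(1 - free_gen gen_a * free_gen gen_b) * free_gen gen_c - 1,
      free_gen gen_c * (1 - free_gen gen_a * free_gen gen_b) - 1}"

definition alg_S :: "(abc free_monoid \<Rightarrow>\<^sub>0 int) set ring" where
  "alg_S = free_algebra Quot rel_ideal"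

definition alg_S_gen :: "abc \<Rightarrow> (abc free_monoid \<Rightarrow>\<^sub>0 int) set" where
  "alg_S_gen g = rel_ideal +>\<^bsub>free_algebra\<^esub> free_gen g"

lemma ideal_rel_ideal: "ideal rel_ideal free_algebra"
  unfolding rel_ideal_def
  by (rule ring.genideal_ideal[OF ring_free_algebra]) (simp add: free_algebra_def)

lemma ring_alg_S: "ring alg_S"
  unfolding alg_S_def by (rule ideal.quotient_is_ring[OF ideal_rel_ideal])

lemma alg_S_gen_closed: "alg_S_gen g \<in> carrier alg_S"
  by (auto simp: alg_S_gen_def alg_S_def FactRing_def A_RCOSETS_def' a_r_coset_def' free_algebra_def)

lemma free_algebra_minus: "x \<ominus>\<^bsub>free_algebra\<^esub> y = x - y"
proof -
  interpret ring free_algebra by (rule ring_free_algebra)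
  have "\<ominus>\<^bsub>free_algebra\<^esub> y = - y"
    by (rule minus_equality) (auto simp: free_algebra_def)
  then show ?thesis
    by (simp add: a_minus_def) (simp add: free_algebra_def)
qed

lemma alg_S_hom: "(\<lambda>p. rel_ideal +>\<^bsub>free_algebra\<^esub> p) \<in> ring_hom free_algebra alg_S"
  unfolding alg_S_def by (rule ideal.rcos_ring_hom[OF ideal_rel_ideal])

lemma alg_S_relations:
  "(\<one>\<^bsub>alg_S\<^esub> \<ominus>\<^bsub>alg_S\<^esub> alg_S_gen gen_a \<otimes>\<^bsub>alg_S\<^esub> alg_S_gen gen_b) \<otimes>\<^bsub>alg_S\<^esub> alg_S_gen gen_c = \<one>\<^bsub>alg_S\<^esub>"
  "alg_S_gen gen_c \<otimes>\<^bsub>alg_S\<^esub> (\<one>\<^bsub>alg_S\<^esub> \<ominus>\<^bsub>alg_S\<^esub> alg_S_gen gen_a \<otimes>\<^bsub>alg_S\<^esub> alg_S_gen gen_b) = \<one>\<^bsub>alg_S\<^esub>"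
proof -
  let ?q = "\<lambda>p. rel_ideal +>\<^bsub>free_algebra\<^esub> p"
  let ?u = "1 - free_gen gen_a * free_gen gen_b"
  interpret F: ring free_algebra by (rule ring_free_algebra)
  interpret H: ring_hom_ring free_algebra alg_S ?q
    by (intro ring_hom_ringI2 ring_free_algebra ring_alg_S alg_S_hom)
  have carr: "p \<in> carrier free_algebra" for p :: "abc free_monoid \<Rightarrow>\<^sub>0 int"
    by (simp add: free_algebra_def)
  have mult: "?q (p * r) = ?q p \<otimes>\<^bsub>alg_S\<^esub> ?q r" for p r
    using H.hom_mult[OF carr carr, of p r] by (simp add: free_algebra_def)
  have one: "?q 1 = \<one>\<^bsub>alg_S\<^esub>"
    using H.hom_one by (simp add: free_algebra_def)
  have minus: "?q (p - r) = ?q p \<ominus>\<^bsub>alg_S\<^esub> ?q r" for p r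
  proof -
    have "?q (p - r) = ?q (p \<oplus>\<^bsub>free_algebra\<^esub> (\<ominus>\<^bsub>free_algebra\<^esub> r))"
      by (simp add: a_minus_def flip: free_algebra_minus)
    also have "\<dots> = ?q p \<ominus>\<^bsub>alg_S\<^esub> ?q r"
      by (simp add: H.hom_add H.hom_a_inv carr a_minus_def)
    finally show ?thesis .
  qed
  have "{?u * free_gen gen_c - 1, free_gen gen_c * ?u - 1} \<subseteq> rel_ideal"
    unfolding rel_ideal_def by (rule F.genideal_self) (simp add: free_algebra_def)
  then have "?q (?u * free_gen gen_c) = ?q 1" "?q (free_gen gen_c * ?u) = ?q 1"
    using F.quotient_eq_iff_same_a_r_cos[OF ideal_rel_ideal carr carr]
    by (simp_all add: free_algebra_minus)
  then show
    "(\<one>\<^bsub>alg_S\<^esub> \<ominus>\<^bsub>alg_S\<^esub> alg_S_gen gen_a \<otimes>\<^bsub>alg_S\<^esub> alg_S_gen gen_b) \<otimes>\<^bsub>alg_S\<^esub> alg_S_gen gen_c = \<one>\<^bsub>alg_S\<^esub>"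
    "alg_S_gen gen_c \<otimes>\<^bsub>alg_S\<^esub> (\<one>\<^bsub>alg_S\<^esub> \<ominus>\<^bsub>alg_S\<^esub> alg_S_gen gen_a \<otimes>\<^bsub>alg_S\<^esub> alg_S_gen gen_b) = \<one>\<^bsub>alg_S\<^esub>"
    by (simp_all add: mult minus one alg_S_gen_def)
qed

end

theory Submission
  imports Defs
begin

text \<open>
  This is Jacobson's lemma: in any ring, if \<open>1 - ab\<close> is invertible then so is \<open>1 - ba\<close>. Expanding
  geometric series formally suggests the inverse, since \<open>1 + ba + baba + \<dots>\<close> equals
  \<open>1 + b (1 + ab + abab + \<dots>) a\<close>; so the candidate is \<open>x = 1 + bca\<close>. The
  verification is purely algebraic: \<open>b\<close> and \<open>a\<close> intertwine the two elements,
  \<open>(1 - ba) b = b (1 - ab)\<close> and \<open>a (1 - ba) = (1 - ab) a\<close>,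
  hence \<open>(1 - ba) bca = b (1 - ab) c a = ba\<close> and \<open>bca (1 - ba) = b c (1 - ab) a = ba\<close>, and adding
  \<open>1 - ba\<close> gives \<open>1\<close> in both cases. Uniqueness is uniqueness of two-sided inverses in a monoid.
\<close>

context ring
begin

lemma one_minus_mult_intertwine:
  assumes "a \<in> carrier R" "b \<in> carrier R"
  shows "(\<one> \<ominus> b \<otimes> a) \<otimes> b = b \<otimes> (\<one> \<ominus> a \<otimes> b)"
  using assms by (simp add: a_minus_def l_distr r_distr l_minus r_minus m_assoc)

text \<open>
  Moving \<open>b\<close> to the left past \<open>1 - ba\<close> brings \<open>1 - ab\<close> next to \<open>c\<close>, where they cancel and leave
  \<open>ba\<close>, exactly the term missing from \<open>1 - ba\<close>.
\<close>

lemma jacobson_right_inverse: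
  assumes [simp]: "a \<in> carrier R" "b \<in> carrier R" "c \<in> carrier R"
    and inv: "(\<one> \<ominus> a \<otimes> b) \<otimes> c = \<one>"
  shows "(\<one> \<ominus> b \<otimes> a) \<otimes> (\<one> \<oplus> b \<otimes> c \<otimes> a) = \<one>"
proof -
  have "(\<one> \<ominus> b \<otimes> a) \<otimes> (b \<otimes> c \<otimes> a) = (\<one> \<ominus> b \<otimes> a) \<otimes> b \<otimes> c \<otimes> a"
    by (simp add: m_assoc)
  also have "\<dots> = b \<otimes> ((\<one> \<ominus> a \<otimes> b) \<otimes> c) \<otimes> a"
    by (simp add: one_minus_mult_intertwine m_assoc)
  also have "\<dots> = b \<otimes> a"
    by (simp add: inv)
  finally have "(\<one> \<ominus> b \<otimes> a) \<otimes> (\<one> \<oplus> b \<otimes> c \<otimes> a) = (\<one> \<ominus> b \<otimes> a) \<oplus> b \<otimes> a"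
    by (simp add: r_distr)
  then show ?thesis
    by (simp add: a_minus_def a_assoc l_neg)
qed

text \<open>
  The mirror image: \<open>a\<close> moves to the right past \<open>1 - ba\<close>, by the intertwining relation with \<open>a\<close> and
  \<open>b\<close> exchanged and read backwards.
\<close>

lemma jacobson_left_inverse:
  assumes [simp]: "a \<in> carrier R" "b \<in> carrier R" "c \<in> carrier R"
    and inv: "c \<otimes> (\<one> \<ominus> a \<otimes> b) = \<one>"
  shows "(\<one> \<oplus> b \<otimes> c \<otimes> a) \<otimes> (\<one> \<ominus> b \<otimes> a) = \<one>"
proof -
  have "b \<otimes> c \<otimes> a \<otimes> (\<one> \<ominus> b \<otimes> a) = b \<otimes> (c \<otimes> (\<one> \<ominus> a \<otimes> b)) \<otimes> a"
    by (simp add: m_assoc flip: one_minus_mult_intertwine)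
  also have "\<dots> = b \<otimes> a"
    by (simp add: inv)
  finally have "(\<one> \<oplus> b \<otimes> c \<otimes> a) \<otimes> (\<one> \<ominus> b \<otimes> a) = (\<one> \<ominus> b \<otimes> a) \<oplus> b \<otimes> a"
    by (simp add: l_distr)
  then show ?thesis
    by (simp add: a_minus_def a_assoc l_neg)
qed

end

theorem theorem3p3:
  shows "\<exists>!x. x \<in> carrier alg_S \<and>
    (\<one>\<^bsub>alg_S\<^esub> \<ominus>\<^bsub>alg_S\<^esub> alg_S_gen gen_b \<otimes>\<^bsub>alg_S\<^esub> alg_S_gen gen_a) \<otimes>\<^bsub>alg_S\<^esub> x = \<one>\<^bsub>alg_S\<^esub> \<and>
    x \<otimes>\<^bsub>alg_S\<^esub> (\<one>\<^bsub>alg_S\<^esub> \<ominus>\<^bsub>alg_S\<^esub> alg_S_gen gen_b \<otimes>\<^bsub>alg_S\<^esub> alg_S_gen gen_a) = \<one>\<^bsub>alg_S\<^esub>"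
proof -
  interpret S: ring alg_S by (rule ring_alg_S)
  let ?a = "alg_S_gen gen_a" and ?b = "alg_S_gen gen_b" and ?c = "alg_S_gen gen_c"
  let ?v = "\<one>\<^bsub>alg_S\<^esub> \<ominus>\<^bsub>alg_S\<^esub> ?b \<otimes>\<^bsub>alg_S\<^esub> ?a"
  let ?x = "\<one>\<^bsub>alg_S\<^esub> \<oplus>\<^bsub>alg_S\<^esub> ?b \<otimes>\<^bsub>alg_S\<^esub> ?c \<otimes>\<^bsub>alg_S\<^esub> ?a"
  note [simp] = alg_S_gen_closed
  have right: "?v \<otimes>\<^bsub>alg_S\<^esub> ?x = \<one>\<^bsub>alg_S\<^esub>"
    by (rule S.jacobson_right_inverse) (simp_all add: alg_S_relations)
  have left: "?x \<otimes>\<^bsub>alg_S\<^esub> ?v = \<one>\<^bsub>alg_S\<^esub>"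
    by (rule S.jacobson_left_inverse) (simp_all add: alg_S_relations)
  show ?thesis
  proof (rule ex1I[of _ ?x])
    fix y
    assume "y \<in> carrier alg_S \<and> ?v \<otimes>\<^bsub>alg_S\<^esub> y = \<one>\<^bsub>alg_S\<^esub> \<and> y \<otimes>\<^bsub>alg_S\<^esub> ?v = \<one>\<^bsub>alg_S\<^esub>"
    then show "y = ?x"
      using right by (intro S.inv_unique[of y ?v ?x]) simp_all
  qed (simp add: left right)
qed

end
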